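(* Let $S$ be a pairwise single-meeting storyline whose event graph $G$ has $n$ vertices, $m\ge 1$ edges and maximum degree $\Delta$, and let $L^{*}$ be the total edge length of an optimal linear ordering of $G$. Then every storyline visualization of $S$ has $\Omega\!\left(\frac{L^{*}-m}{2\Delta}\right)$ crossings.
   Context: A storyline $S=(C,\mathcal{T},\mathcal{E})$ consists of a set of characters $C=\{1,\dots,n\}$, a set $\mathcal{T}$ of closed time intervals $[s,t]$ with $s,t\in\mathbb{N}$, $s\le t$, and a set of events $\mathcal{E}\subseteq 2^C\times\mathcal{T}$; an event $E_i=(C_i,[s_i,t_i])$ means the characters in $C_i$ meet during the whole interval $[s_i,t_i]$, and no character participates in two events with overlapping time intervals. A storyline visualization is a drawing in the plane in which the $x$-axis represents time and each character is drawn as an $x$-monotone curve, so that at each time the curves appear in some vertical order; during each event $(C_i,[s_i,t_i])$ the curves of the characters in $C_i$ are grouped within a small vertical distance $\delta_{\mathrm{group}}$ of one another (in particular they are consecutive in the vertical order), while otherwise curves are separated by a larger vertical distance $\delta_{\mathrm{separate}}>\delta_{\mathrm{group}}$. The number of crossings of a visualization is the total number of crossing points between pairs of character curves. A storyline is pairwise single-meeting if every event involves exactly two characters and every pair of characters meets in at most one event. Its event graph is the graph with vertex set $C$ having an edge $\{u,v\}$ for each event $(\{u,v\},[s,t])$. An optimal linear ordering of a graph $G=(V,E)$ with $|V|=n$ is a bijection $\pi:V\to\{1,\dots,n\}$ minimizing $\sum_{\{u,v\}\in E}|\pi(u)-\pi(v)|$; $L^{*}$ denotes this minimum value. *)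

theory Defs
  imports Complex_Main
begin

(* An interval (s, t) stands for the closed real interval from s to t;
   an event (C, s, t) is the meeting of the characters in C during that interval. *)
record storyline =
  num_characters :: nat
  intervals :: "(nat \<times> nat) set"
  events :: "(nat set \<times> nat \<times> nat) set"

definition characters :: "storyline \<Rightarrow> nat set" where
  "characters S = {1..num_characters S}"

definition time_span :: "nat \<times> nat \<Rightarrow> real set" where
  "time_span = (\<lambda>(s, t). {real s..real t})"

definition is_storyline :: "storyline \<Rightarrow> bool" where
  "is_storyline S \<longleftrightarrow>
     (\<forall>(s, t) \<in> intervals S. s \<le> t) \<and>
     events S \<subseteq> Pow (characters S) \<times> intervals S \<and>
     (\<forall>(C, I) \<in> events S. \<forall>(C', I') \<in> events S.
        (C, I) \<noteq> (C', I') \<and> C \<inter> C' \<noteq> {} \<longrightarrow> time_span I \<inter> time_span I' = {})"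

definition pairwise_single_meeting :: "storyline \<Rightarrow> bool" where
  "pairwise_single_meeting S \<longleftrightarrow>
     (\<forall>(C, I) \<in> events S. card C = 2) \<and>
     (\<forall>u v. u \<noteq> v \<longrightarrow> (\<forall>(C, I) \<in> events S. \<forall>(C', I') \<in> events S.
        {u, v} \<subseteq> C \<and> {u, v} \<subseteq> C' \<longrightarrow> (C, I) = (C', I')))"

(* The event graph has vertex set characters S and the following edge set. *)
definition event_edges :: "storyline \<Rightarrow> nat set set" where
  "event_edges S = {C. \<exists>I. (C, I) \<in> events S}"

definition degree :: "nat set set \<Rightarrow> nat \<Rightarrow> nat" where
  "degree E v = card {e \<in> E. v \<in> e}"

definition max_degree :: "nat set \<Rightarrow> nat set set \<Rightarrow> nat" where
  "max_degree V E = Max (degree E ` V)"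

definition linear_ordering :: "nat set \<Rightarrow> (nat \<Rightarrow> nat) \<Rightarrow> bool" where
  "linear_ordering V \<pi> \<longleftrightarrow> bij_betw \<pi> V {1..card V}"

(* The condition u < v makes every edge {u, v} contribute exactly once. *)
definition total_edge_length :: "nat set set \<Rightarrow> (nat \<Rightarrow> nat) \<Rightarrow> nat" where
  "total_edge_length E \<pi> =
     (\<Sum>(u, v) \<in> {(u, v). u < v \<and> {u, v} \<in> E}. nat \<bar>int (\<pi> u) - int (\<pi> v)\<bar>)"

definition optimal_length :: "nat set \<Rightarrow> nat set set \<Rightarrow> nat" where
  "optimal_length V E =
     (LEAST L. \<exists>\<pi>. linear_ordering V \<pi> \<and> L = total_edge_length E \<pi>)"

(* The curve of character u is the graph of y u over the time window [a, b].
   Distinct curves share only finitely many points, so that crossing points are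
   well defined.  During an event its participants stay within d_group of one
   another and at least d_separate away from everybody else.  No separation is
   imposed on two characters that are both idle, as otherwise they could never
   change their vertical order. *)
definition storyline_visualization ::
    "storyline \<Rightarrow> real \<Rightarrow> real \<Rightarrow> real \<Rightarrow> real \<Rightarrow> (nat \<Rightarrow> real \<Rightarrow> real) \<Rightarrow> bool" where
  "storyline_visualization S d_group d_separate a b y \<longleftrightarrow>
     0 < d_group \<and> d_group < d_separate \<and> a < b \<and>
     (\<forall>(C, I) \<in> events S. time_span I \<subseteq> {a..b}) \<and>
     (\<forall>u \<in> characters S. continuous_on {a..b} (y u)) \<and>
     (\<forall>u \<in> characters S. \<forall>v \<in> characters S. u \<noteq> v \<longrightarrow>
        finite {t \<in> {a..b}. y u t = y v t}) \<and>
     (\<forall>(C, I) \<in> events S. \<forall>t \<in> time_span I.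
        (\<forall>u \<in> C. \<forall>v \<in> C. \<bar>y u t - y v t\<bar> \<le> d_group) \<and>
        (\<forall>u \<in> C. \<forall>w \<in> characters S - C. d_separate \<le> \<bar>y u t - y w t\<bar>))"

lemma participants_consecutive:
  assumes "storyline_visualization S d_group d_separate a b y"
    and "(C, I) \<in> events S" "t \<in> time_span I" "u \<in> C" "v \<in> C" "w \<in> characters S - C"
  shows "\<not> (y u t \<le> y w t \<and> y w t \<le> y v t)"
proof -
  have "\<bar>y u t - y v t\<bar> \<le> d_group" "d_separate \<le> \<bar>y u t - y w t\<bar>" "d_group < d_separate"
    using assms unfolding storyline_visualization_def by fast+
  then show ?thesis by linarith
qed

(* (u, v, t) records that u passes from below v to above v at time t.  Fixing this
   orientation counts every crossing point of the pair {u, v} exactly once, and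
   points where two curves merely touch are not counted. *)
definition crossings ::
    "storyline \<Rightarrow> real \<Rightarrow> real \<Rightarrow> (nat \<Rightarrow> real \<Rightarrow> real) \<Rightarrow> (nat \<times> nat \<times> real) set" where
  "crossings S a b y =
     {(u, v, t). u \<in> characters S \<and> v \<in> characters S \<and> a < t \<and> t < b \<and> y u t = y v t \<and>
        (\<forall>\<^sub>F s in at_left t. y u s < y v s) \<and> (\<forall>\<^sub>F s in at_right t. y v s < y u s)}"

definition num_crossings ::
    "storyline \<Rightarrow> real \<Rightarrow> real \<Rightarrow> (nat \<Rightarrow> real \<Rightarrow> real) \<Rightarrow> nat" where
  "num_crossings S a b y = card (crossings S a b y)"

end

theory Submission
  imports Defs
begin

text \<open>
  Order the characters by height at a time \<open>t\<^sub>0\<close> at which no two curves meet; this is a linear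
  ordering, so its length is at least the optimum.  If \<open>u\<close> and \<open>v\<close> meet at some time, then every
  character strictly between them at \<open>t\<^sub>0\<close> must have left the gap by then and therefore crosses
  \<open>u\<close> or \<open>v\<close>.  Hence an edge of length \<open>d\<close> is incident to at least \<open>d - 1\<close> crossing pairs, whereas
  a crossing pair meets at most \<open>2 * \<Delta>\<close> edges,
  \<open>\<Delta>\<close> being the maximum degree.
\<close>

section \<open>Sign changes of continuous functions and crossings forced by a change of
  order\<close>

text \<open>A zero supplied by the intermediate value theorem may be a mere touching point. The zero
  that opens the first positive stretch of \<open>f\<close> is a genuine sign change, and it exists
  because the zeros are finite in number.\<close>

lemma exists_upward_crossing:
  fixes f :: "real \<Rightarrow> real"
  assumes st: "s < t" and cont: "continuous_on {s..t} f"
    and fin: "finite {x \<in> {s..t}. f x = 0}"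
    and fs: "f s < 0" and ft: "f t > 0"
  obtains z where "s < z" "z < t" "f z = 0"
    "\<forall>\<^sub>F x in at_left z. f x < 0" "\<forall>\<^sub>F x in at_right z. f x > 0"
proof -
  define Z where "Z = {x \<in> {s..t}. f x = 0}"
  have finZ: "finite Z" using fin by (simp add: Z_def)
  have root: "\<exists>z\<in>Z. x < z \<and> z < y" if xy: "s \<le> x" "x \<le> y" "y \<le> t" "f x < 0" "f y > 0" for x y
  proof -
    have "continuous_on {x..y} f"
      using cont by (rule continuous_on_subset) (use xy in auto)
    then obtain z where z: "x \<le> z" "z \<le> y" "f z = 0"
      using IVT'[of f x 0 y] xy by auto
    with xy have "z \<noteq> x" "z \<noteq> y" by auto
    with z xy show ?thesis by (intro bexI[of _ z]) (auto simp: Z_def)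
  qed
  \<comment> \<open>\<open>Q\<close> holds the zeros before which \<open>f\<close> has already been
    positive, with \<open>t\<close> added to make it nonempty. A positive point \<open>p\<close> up
    to \<open>Min Q\<close> lies in the first positive stretch, and the last zero before
    \<open>p\<close> opens that stretch.\<close>
  define Q where "Q = {q \<in> insert t Z. \<exists>p\<in>{s..q}. f p > 0}"
  have finQ: "finite Q" using finZ by (simp add: Q_def)
  have "t \<in> Q" using st ft by (auto simp: Q_def)
  then have minQ: "Min Q \<in> Q" using finQ by (intro Min_in) auto
  then obtain p where p: "s \<le> p" "p \<le> Min Q" "f p > 0" by (auto simp: Q_def)
  have "p \<le> t" using p minQ by (auto simp: Q_def Z_def)
  define B where "B = {x \<in> Z. x < p}"
  have finB: "finite B" using finZ by (simp add: B_def)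
  have "B \<noteq> {}" using root[of s p] p fs \<open>p \<le> t\<close> by (auto simp: B_def)
  define z where "z = Max B"
  have "z \<in> B" using finB \<open>B \<noteq> {}\<close> by (simp add: z_def)
  then have zZ: "z \<in> Z" and zp: "z < p" by (auto simp: B_def)
  then have fz: "f z = 0" and "s \<le> z" "z \<le> t" by (auto simp: Z_def)
  have "s < z" using fz fs \<open>s \<le> z\<close> by (cases "s = z") auto
  have "z < t" using fz ft \<open>z \<le> t\<close> by (cases "z = t") auto
  have right: "f x > 0" if zxp: "z < x" "x < p" for x
  proof (rule ccontr)
    assume "\<not> f x > 0"
    then consider "f x = 0" | "f x < 0" by linarith
    then have "\<exists>r\<in>Z. z < r \<and> r < p"
    proof cases
      case 1
      then have "x \<in> Z" using zxp \<open>s \<le> z\<close> \<open>p \<le> t\<close> by (simp add: Z_def)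
      then show ?thesis using zxp by blast
    next
      case 2
      then obtain r where "r \<in> Z" "x < r" "r < p"
        using root[of x p] zxp p \<open>s \<le> z\<close> \<open>p \<le> t\<close> by force
      then show ?thesis using zxp by (intro bexI[of _ r]) auto
    qed
    then obtain r where "r \<in> B" "z < r" by (auto simp: B_def)
    then show False using Max_ge[OF finB] by (fastforce simp: z_def)
  qed
  \<comment> \<open>As \<open>z < p\<close> and \<open>p \<le> Min Q\<close>, a positive value at or
    before \<open>z\<close> would put \<open>z\<close> into \<open>Q\<close> below its
    minimum.\<close>
  have "z \<notin> Q" using Min_le[OF finQ, of z] zp p by auto
  then have nonpos: "f x \<le> 0" if "s \<le> x" "x \<le> z" for x
    using that zZ by (force simp: Q_def)
  \<comment> \<open>The previous zero, or \<open>s\<close> if \<open>z\<close> is the first one;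
    between \<open>l\<close> and \<open>z\<close> the function is nonpositive without zeros, hence
    negative.\<close>
  define l where "l = Max (insert s {x \<in> Z. x < z})"
  have l: "l < z" using finZ \<open>s < z\<close> by (simp add: l_def)
  have left: "f x < 0" if "l < x" "x < z" for x
  proof -
    have sx: "s \<le> x" using that finZ by (auto simp: l_def)
    have "x \<notin> Z" using that finZ by (auto simp: l_def)
    with nonpos[of x] sx that \<open>z \<le> t\<close> show ?thesis by (fastforce simp: Z_def)
  qed
  have "\<forall>\<^sub>F x in at_left z. f x < 0"
    using left l eventually_at_left[OF l] by blast
  moreover have "\<forall>\<^sub>F x in at_right z. f x > 0"
    using right zp eventually_at_right[OF zp] by blast
  ultimately show thesis using that \<open>s < z\<close> \<open>z < t\<close> fz by blast
qed

lemma upward_crossing_if_order_changes: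
  assumes vis: "storyline_visualization S dg ds a b y"
    and uv: "u \<in> characters S" "v \<in> characters S"
    and t: "t \<in> {a..b}" "t' \<in> {a..b}" "t < t'"
    and less: "y u t < y v t" "y v t' < y u t'"
  shows "\<exists>z. (u, v, z) \<in> crossings S a b y"
proof -
  let ?f = "\<lambda>x. y u x - y v x"
  have "u \<noteq> v" using less by auto
  have "continuous_on {a..b} ?f" "finite {x \<in> {a..b}. y u x = y v x}"
    using vis uv \<open>u \<noteq> v\<close> unfolding storyline_visualization_def
    by (auto intro: continuous_on_diff)
  then have "continuous_on {t..t'} ?f" "finite {x \<in> {t..t'}. ?f x = 0}"
    using t by (auto intro: continuous_on_subset elim!: finite_subset[rotated])
  then obtain z where "t < z" "z < t'" "?f z = 0"
    "\<forall>\<^sub>F x in at_left z. ?f x < 0" "\<forall>\<^sub>F x in at_right z. ?f x > 0"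
    using exists_upward_crossing[of t t' ?f] t less by auto
  then have "(u, v, z) \<in> crossings S a b y"
    using t uv by (simp add: crossings_def)
  then show ?thesis ..
qed

text \<open>Pairs are unordered and without times, so repeated crossings of two curves, in either
  direction, collapse to one element. This only lowers the count, which suits a lower bound.\<close>

definition crossing_pairs ::
    "storyline \<Rightarrow> real \<Rightarrow> real \<Rightarrow> (nat \<Rightarrow> real \<Rightarrow> real) \<Rightarrow> nat set set" where
  "crossing_pairs S a b y = (\<lambda>(u, v, t). {u, v}) ` crossings S a b y"

text \<open>The reference time may precede or follow the meeting; reversing time swaps which curve
  passes upwards, and an unordered pair does not see this.\<close>

lemma crossing_pair_if_order_changes:
  assumes "storyline_visualization S dg ds a b y"
    and "u \<in> characters S" "v \<in> characters S"
    and "t \<in> {a..b}" "t' \<in> {a..b}"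
    and "y u t < y v t" "y v t' < y u t'"
  shows "{u, v} \<in> crossing_pairs S a b y"
proof -
  have "\<exists>z. (u, v, z) \<in> crossings S a b y \<or> (v, u, z) \<in> crossings S a b y"
  proof (cases t t' rule: linorder_cases)
    case less
    then show ?thesis using upward_crossing_if_order_changes assms by blast
  next
    case greater
    then show ?thesis using upward_crossing_if_order_changes assms by blast
  qed (use assms in auto)
  then show ?thesis by (force simp: crossing_pairs_def insert_commute)
qed

section \<open>Finiteness of crossings and a time without ties\<close>

lemma finite_characters [simp]: "finite (characters S)"
  by (simp add: characters_def)

lemma finite_crossings:
  assumes "storyline_visualization S dg ds a b y"
  shows "finite (crossings S a b y)"
proof -
  \<comment> \<open>The diagonal is cut out because a curve agrees with itself at all times; no
    crossing is lost, since a curve is never strictly below itself.\<close>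
  let ?T = "\<lambda>u v. if u = v then {} else {t \<in> {a..b}. y u t = y v t}"
  have "finite (SIGMA u:characters S. SIGMA v:characters S. ?T u v)"
    using assms by (intro finite_SigmaI) (auto simp: storyline_visualization_def)
  moreover have "crossings S a b y \<subseteq> (SIGMA u:characters S. SIGMA v:characters S. ?T u v)"
    by (auto simp: crossings_def)
  ultimately show ?thesis by (rule finite_subset[rotated])
qed

lemma exists_time_without_ties:
  assumes "storyline_visualization S dg ds a b y"
  obtains t where "t \<in> {a..b}" "inj_on (\<lambda>u. y u t) (characters S)"
proof -
  let ?V = "characters S"
  let ?T = "\<Union>u\<in>?V. \<Union>v\<in>?V - {u}. {t \<in> {a..b}. y u t = y v t}"
  have "finite ?T" "infinite {a..b}"
    using assms by (auto simp: storyline_visualization_def infinite_Icc_iff)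
  then obtain t where "t \<in> {a..b}" "t \<notin> ?T"
    by (meson finite_subset subsetI)
  then show thesis
    using that by (force simp: inj_on_def)
qed

section \<open>Linear orderings obtained from heights\<close>

text \<open>The non-strict comparison counts \<open>u\<close> itself, so ranks start at 1 as
  \<open>linear_ordering\<close> demands.\<close>

definition rank :: "'a set \<Rightarrow> ('a \<Rightarrow> real) \<Rightarrow> 'a \<Rightarrow> nat" where
  "rank V h u = card {w \<in> V. h w \<le> h u}"

text \<open>The summand 1 is \<open>v\<close> itself. Added up over all edges, these ones become the
  number of edges in the final bound.\<close>

lemma rank_diff:
  assumes "finite V" "inj_on h V" "u \<in> V" "v \<in> V" "h u < h v"
  shows "rank V h v = rank V h u + card {w \<in> V. h u < h w \<and> h w < h v} + 1"
proof -
  have "{w \<in> V. h w \<le> h v} = insert v ({w \<in> V. h w \<le> h u} \<union> {w \<in> V. h u < h w \<and> h w < h v})"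
    using assms by (force simp: inj_on_def)
  moreover have "card ({w \<in> V. h w \<le> h u} \<union> {w \<in> V. h u < h w \<and> h w < h v})
      = rank V h u + card {w \<in> V. h u < h w \<and> h w < h v}"
    unfolding rank_def using assms by (intro card_Un_disjoint) auto
  ultimately show ?thesis
    using assms by (simp add: rank_def)
qed

lemma linear_ordering_rank:
  assumes "finite V" "inj_on h V"
  shows "linear_ordering V (rank V h)"
proof -
  have inj: "inj_on (rank V h) V"
  proof (rule inj_onI)
    fix u v assume uv: "u \<in> V" "v \<in> V" "rank V h u = rank V h v"
    then have "h u = h v"
      using rank_diff[OF assms, of u v] rank_diff[OF assms, of v u]
      by (cases "h u" "h v" rule: linorder_cases) auto
    then show "u = v" using uv assms by (auto dest: inj_onD)
  qed
  have "rank V h u \<in> {1..card V}" if "u \<in> V" for u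
  proof -
    have "rank V h u \<le> card V" unfolding rank_def using assms by (intro card_mono) auto
    moreover have "{w \<in> V. h w \<le> h u} \<noteq> {}" using that by auto
    then have "0 < rank V h u" unfolding rank_def using assms by (simp add: card_gt_0_iff)
    ultimately show ?thesis by simp
  qed
  then have "rank V h ` V = {1..card V}"
    using assms inj by (intro card_subset_eq) (auto simp: card_image)
  then show ?thesis using inj by (simp add: linear_ordering_def bij_betw_def)
qed

section \<open>Double counting of edges against crossing pairs\<close>

text \<open>Turns the sum over ordered pairs in \<open>total_edge_length\<close> into a sum over
  edges, the form needed for double counting.\<close>

lemma bij_betw_ordered_pairs_edges:
  fixes E :: "nat set set"
  assumes "\<forall>e\<in>E. card e = 2"
  shows "bij_betw (\<lambda>(u, v). {u, v}) {(u, v). u < v \<and> {u, v} \<in> E} E"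
  unfolding bij_betw_def
proof
  show "inj_on (\<lambda>(u, v). {u, v}) {(u, v). u < v \<and> {u, v} \<in> E}"
    by (auto simp: inj_on_def doubleton_eq_iff)
  have "e \<in> (\<lambda>(u, v). {u, v}) ` {(u, v). u < v \<and> {u, v} \<in> E}" if "e \<in> E" for e
  proof -
    have "card e = 2" using assms that by blast
    then obtain u v where "e = {u, v}" "u \<noteq> v" by (auto simp: card_2_iff)
    then obtain u v where "e = {u, v}" "u < v"
      by (metis insert_commute linorder_neqE_nat)
    then show ?thesis using that by (intro image_eqI[of _ _ "(u, v)"]) auto
  qed
  then show "(\<lambda>(u, v). {u, v}) ` {(u, v). u < v \<and> {u, v} \<in> E} = E" by auto
qed

lemma between_le_crossing_pairs:
  assumes vis: "storyline_visualization S dg ds a b y"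
    and ev: "(C, I) \<in> events S" and CV: "C \<subseteq> characters S" and uv: "u \<in> C" "v \<in> C" "C = {u, v}"
    and t': "t' \<in> time_span I" and t: "t \<in> {a..b}"
  shows "card {w \<in> characters S. y u t < y w t \<and> y w t < y v t}
           \<le> card {p \<in> crossing_pairs S a b y. C \<inter> p \<noteq> {}}" (is "card ?B \<le> card ?P")
proof -
  have t'ab: "t' \<in> {a..b}"
    using vis ev t' unfolding storyline_visualization_def by fast
  have exit: "\<exists>x\<in>C. {x, w} \<in> crossing_pairs S a b y" if w: "w \<in> ?B" for w
  proof -
    have wC: "w \<in> characters S - C" using w uv by auto
    from participants_consecutive[OF vis ev t' \<open>u \<in> C\<close> \<open>v \<in> C\<close> wC]
    consider "y w t' < y u t'" | "y v t' < y w t'" by linarith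
    then show ?thesis
    proof cases
      case 1
      then have "{u, w} \<in> crossing_pairs S a b y"
        using crossing_pair_if_order_changes[OF vis, of u w t t'] w wC uv CV t t'ab by auto
      then show ?thesis using uv by blast
    next
      case 2
      then have "{w, v} \<in> crossing_pairs S a b y"
        using crossing_pair_if_order_changes[OF vis, of w v t t'] w wC uv CV t t'ab by auto
      then show ?thesis using uv by (metis insert_commute)
    qed
  qed
  then obtain x where x: "\<And>w. w \<in> ?B \<Longrightarrow> x w \<in> C \<and> {x w, w} \<in> crossing_pairs S a b y"
    by metis
  have notC: "w \<notin> C" if "w \<in> ?B" for w using that uv by auto
  \<comment> \<open>\<open>w\<close> can be read off from \<open>{x w, w}\<close> as its only
    element outside \<open>C\<close>.\<close>
  have "inj_on (\<lambda>w. {x w, w}) ?B"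
  proof (rule inj_onI)
    fix w w' assume w: "w \<in> ?B" "w' \<in> ?B" "{x w, w} = {x w', w'}"
    then have "w \<in> {x w', w'}" by auto
    then show "w = w'" using x[OF w(2)] notC[OF w(1)] by auto
  qed
  moreover have "(\<lambda>w. {x w, w}) ` ?B \<subseteq> ?P" using x by auto
  moreover have "finite ?P"
    using finite_crossings[OF vis] by (simp add: crossing_pairs_def)
  ultimately show ?thesis by (rule card_inj_on_le)
qed

text \<open>The bound is stated multiplied out, so that it stays within the natural numbers, free of
  truncated subtraction and division.\<close>

lemma optimal_length_le_crossings:
  assumes S: "is_storyline S" and single: "pairwise_single_meeting S"
    and vis: "storyline_visualization S dg ds a b y"
  shows "optimal_length (characters S) (event_edges S)
    \<le> card (event_edges S)
       + num_crossings S a b y * (2 * max_degree (characters S) (event_edges S))"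
proof -
  define V E P where "V = characters S" and "E = event_edges S" and "P = crossing_pairs S a b y"
  define \<Delta> where "\<Delta> = max_degree V E"
  have EV: "E \<subseteq> Pow V" using S unfolding E_def V_def is_storyline_def event_edges_def by fast
  then have finE: "finite E" by (rule finite_subset) (simp add: V_def)
  have E2: "\<forall>e\<in>E. card e = 2"
    using single unfolding E_def pairwise_single_meeting_def event_edges_def by fast
  have finP: "finite P" and cardP: "card P \<le> num_crossings S a b y"
    using finite_crossings[OF vis]
    by (auto simp: P_def crossing_pairs_def num_crossings_def intro: card_image_le)
  obtain t where t: "t \<in> {a..b}" and inj: "inj_on (\<lambda>u. y u t) V"
    using exists_time_without_ties[OF vis] unfolding V_def by blast
  define \<pi> where "\<pi> = rank V (\<lambda>u. y u t)"
  define h where "h e = card {p \<in> P. e \<inter> p \<noteq> {}}" for e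
  have finV: "finite V" by (simp add: V_def)
  have between: "card {w \<in> V. y u t < y w t \<and> y w t < y v t} \<le> h {u, v}"
    if "{u, v} \<in> E" for u v
  proof -
    obtain i j where ev: "({u, v}, i, j) \<in> events S"
      using \<open>{u, v} \<in> E\<close> by (auto simp: E_def event_edges_def)
    have "i \<le> j" using S ev unfolding is_storyline_def by fast
    \<comment> \<open>A single moment of the meeting suffices; the start \<open>i\<close> is one
      because \<open>i \<le> j\<close>.\<close>
    then have "real i \<in> time_span (i, j)" by (simp add: time_span_def)
    then show ?thesis
      unfolding h_def P_def V_def using between_le_crossing_pairs[OF vis ev _ _ _ refl] t
        \<open>{u, v} \<in> E\<close> EV by (auto simp: V_def)
  qed
  have edge: "nat \<bar>int (\<pi> u) - int (\<pi> v)\<bar> \<le> 1 + h {u, v}" if uv: "{u, v} \<in> E" "u < v" for u v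
  proof -
    have V: "u \<in> V" "v \<in> V" using EV uv by auto
    have "y u t \<noteq> y v t" using inj V uv by (auto dest: inj_onD)
    then consider "y u t < y v t" | "y v t < y u t" by linarith
    then show ?thesis
    proof cases
      case 1
      then show ?thesis
        using rank_diff[OF finV inj V] between[of u v] uv by (simp add: \<pi>_def)
    next
      case 2
      then show ?thesis
        using rank_diff[OF finV inj V(2,1)] between[of v u] uv by (simp add: \<pi>_def insert_commute)
    qed
  qed
  let ?A = "{(u, v). u < v \<and> {u, v} \<in> E}"
  have bij: "bij_betw (\<lambda>(u, v). {u, v}) ?A E" by (rule bij_betw_ordered_pairs_edges[OF E2])
  have "optimal_length V E \<le> total_edge_length E \<pi>"
    unfolding optimal_length_def \<pi>_def
    using linear_ordering_rank[OF finV inj] by (intro Least_le) blast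
  also have "\<dots> \<le> (\<Sum>x\<in>?A. 1 + h ((\<lambda>(u, v). {u, v}) x))"
    unfolding total_edge_length_def by (intro sum_mono) (use edge in auto)
  also have "\<dots> = (\<Sum>e\<in>E. 1 + h e)"
    by (rule sum.reindex_bij_betw[OF bij])
  also have "\<dots> = card E + (\<Sum>e\<in>E. h e)"
    by (simp only: sum.distrib) simp
  \<comment> \<open>Both sides count the incidences of an edge \<open>e\<close> and a crossing pair
    \<open>p\<close> sharing a character.\<close>
  also have "(\<Sum>e\<in>E. h e) = (\<Sum>p\<in>P. card {e \<in> E. e \<inter> p \<noteq> {}})"
    unfolding h_def by (rule sum_multicount_gen[OF finE finP]) simp
  also have "\<dots> \<le> (\<Sum>p\<in>P. 2 * \<Delta>)"
  proof (rule sum_mono)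
    fix p assume "p \<in> P"
    then obtain u v where p: "p = {u, v}" "u \<in> V" "v \<in> V"
      by (auto simp: P_def crossing_pairs_def crossings_def V_def)
    have deg: "degree E x \<le> \<Delta>" if "x \<in> V" for x
      unfolding \<Delta>_def max_degree_def using finV that by (intro Max_ge) auto
    \<comment> \<open>An edge meeting \<open>p\<close> contains \<open>u\<close> or
      \<open>v\<close>, whence two degrees; the edge \<open>{u, v}\<close> may be counted
      twice.\<close>
    have "{e \<in> E. e \<inter> p \<noteq> {}} = {e \<in> E. u \<in> e} \<union> {e \<in> E. v \<in> e}"
      using p by auto
    then have "card {e \<in> E. e \<inter> p \<noteq> {}} \<le> degree E u + degree E v"
      unfolding degree_def by (simp add: card_Un_le)
    then show "card {e \<in> E. e \<inter> p \<noteq> {}} \<le> 2 * \<Delta>" using deg[OF p(2)] deg[OF p(3)] by linarith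
  qed
  also have "\<dots> \<le> num_crossings S a b y * (2 * \<Delta>)" using cardP by simp
  finally show ?thesis unfolding V_def E_def \<Delta>_def by simp
qed

theorem theorem2:
  "\<exists>c::real. c > 0 \<and>
     (\<forall>S d_group d_separate a b y.
        is_storyline S \<and> pairwise_single_meeting S \<and> card (event_edges S) \<ge> 1 \<and>
        storyline_visualization S d_group d_separate a b y \<longrightarrow>
        real (num_crossings S a b y) \<ge>
          c * ((real (optimal_length (characters S) (event_edges S)) - real (card (event_edges S))) /
               (2 * real (max_degree (characters S) (event_edges S)))))"
proof (intro exI[of _ 1] conjI allI impI)
  fix S d_group d_separate a b y
  assume "is_storyline S \<and> pairwise_single_meeting S \<and> card (event_edges S) \<ge> 1 \<and>
        storyline_visualization S d_group d_separate a b y"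
  then have "optimal_length (characters S) (event_edges S)
    \<le> card (event_edges S)
       + num_crossings S a b y * (2 * max_degree (characters S) (event_edges S))"
    (is "?L \<le> ?m + ?k * (2 * ?D)")
    using optimal_length_le_crossings by blast
  then have "real ?L \<le> real (?m + ?k * (2 * ?D))" by (rule of_nat_mono)
  then have le: "real ?L - real ?m \<le> real ?k * (2 * real ?D)" by simp
  have "(real ?L - real ?m) / (2 * real ?D) \<le> real ?k"
  \<comment> \<open>For \<open>?D = 0\<close> the quotient is 0 by the convention on division by
    zero.\<close>
  proof (cases "?D = 0")
    case False
    then show ?thesis using le by (simp add: pos_divide_le_eq)
  qed simp
  then show "1 * ((real ?L - real ?m) / (2 * real ?D)) \<le> real ?k" by simp
qed simp

end
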